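(* Let $f,g$, $\mathcal{L}^{\mu,\mu}[f]$ and $\mathcal{L}^{\mu,\mu}[g]$ all belong to $L^{1}\cap L^{2}(\mathbb{R}^2, \mathbb{H}(\mu))$, and let $r$ be the function defined by $$\overline{r(\tau_{1},\tau_{2})}=e^{\mu\tau_{1}^{2}\frac{a_{1}}{b_{1}}}\,g(-\tau_{1},-\tau_{2})\,e^{\mu\tau_{2}^{2}\frac{a_{2}}{b_{2}}}.$$ Then $$\int_{\mathbb{R}^{2}}f(\tau_{1},\tau_{2})\,\overline{r(\tau_{1},\tau_{2})}\,d\tau_{1}d\tau_{2}=\int_{\mathbb{R}^{2}}\mathcal{L}^{\mu,\mu}[f](u,v)\,\overline{\mathcal{L}^{\mu,\mu}[r](u,v)}\,du\,dv.$$
   Context: $\mathbb H$ is the quaternion algebra with real basis $1,\mu,\nu,\eta$, where $\mu^2=\nu^2=\eta^2=\mu\nu\eta=-1$, $\mu\nu=-\nu\mu=\eta$; $\overline q$ is quaternion conjugation. $\mathbb H(\mu)=\{q_r+\mu q_\mu:q_r,q_\mu\in\mathbb R\}$. $L^p(\mathbb R^2,\mathbb H(\mu))$ is the space of $f:\mathbb R^2\to\mathbb H(\mu)$ with $\|f\|_p=(\int_{\mathbb R^2}|f|^p\,dx\,dy)^{1/p}<\infty$. $A_i=\begin{pmatrix}a_i&b_i\\c_i&d_i\end{pmatrix}$, $i=1,2$, are real matrices with $a_id_i-b_ic_i=1$ and $b_i\neq0$. With $$K_{A}^{\mu}(x,u)=\frac{1}{\sqrt{2\pi b\mu}}\,e^{\mu(\frac{a}{2b}x^2-\frac1b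 xu+\frac{d}{2b}u^2)}\quad\text{for }A=\begin{pmatrix}a&b\\c&d\end{pmatrix}$$ (principal square root in $\mathbb H(\mu)\cong\mathbb C$), the quaternion linear canonical transform of an integrable $f$ is $\mathcal L^{\mu,\mu}[f](u,v)=\int_{\mathbb R^2}K^{\mu}_{A_1}(x,u)f(x,y)K^{\mu}_{A_2}(y,v)\,dx\,dy$. *)

theory Defs
  imports "HOL-Analysis.Analysis"
begin

section \<open>The quaternion algebra with units mu, nu, eta\<close>

codatatype quat = Quat (q_re: real) (q_mu: real) (q_nu: real) (q_eta: real)

lemma quat_eq_iff:
  "p = q \<longleftrightarrow> q_re p = q_re q \<and> q_mu p = q_mu q \<and> q_nu p = q_nu q \<and> q_eta p = q_eta q"
  by (auto intro: quat.expand)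

instantiation quat :: ab_group_add
begin

primcorec zero_quat where
  "q_re 0 = 0" | "q_mu 0 = 0" | "q_nu 0 = 0" | "q_eta 0 = 0"

primcorec plus_quat where
  "q_re (p + q) = q_re p + q_re q"
| "q_mu (p + q) = q_mu p + q_mu q"
| "q_nu (p + q) = q_nu p + q_nu q"
| "q_eta (p + q) = q_eta p + q_eta q"

primcorec uminus_quat where
  "q_re (- p) = - q_re p"
| "q_mu (- p) = - q_mu p"
| "q_nu (- p) = - q_nu p"
| "q_eta (- p) = - q_eta p"

primcorec minus_quat where
  "q_re (p - q) = q_re p - q_re q"
| "q_mu (p - q) = q_mu p - q_mu q"
| "q_nu (p - q) = q_nu p - q_nu q"
| "q_eta (p - q) = q_eta p - q_eta q"

instance
  by standard (simp_all add: quat_eq_iff)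

end

instantiation quat :: ring_1
begin

primcorec one_quat where
  "q_re 1 = 1" | "q_mu 1 = 0" | "q_nu 1 = 0" | "q_eta 1 = 0"

primcorec times_quat where
  "q_re (p * q) = q_re p * q_re q - q_mu p * q_mu q - q_nu p * q_nu q - q_eta p * q_eta q"
| "q_mu (p * q) = q_re p * q_mu q + q_mu p * q_re q + q_nu p * q_eta q - q_eta p * q_nu q"
| "q_nu (p * q) = q_re p * q_nu q - q_mu p * q_eta q + q_nu p * q_re q + q_eta p * q_mu q"
| "q_eta (p * q) = q_re p * q_eta q + q_mu p * q_nu q - q_nu p * q_mu q + q_eta p * q_re q"

instance
  by standard (simp_all add: quat_eq_iff algebra_simps)

end

instantiation quat :: real_algebra_1
begin

primcorec scaleR_quat where
  "q_re (scaleR t q) = t * q_re q"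
| "q_mu (scaleR t q) = t * q_mu q"
| "q_nu (scaleR t q) = t * q_nu q"
| "q_eta (scaleR t q) = t * q_eta q"

instance
  by standard (simp_all add: quat_eq_iff algebra_simps)

end

primcorec qcnj :: "quat \<Rightarrow> quat" where
  "q_re (qcnj q) = q_re q"
| "q_mu (qcnj q) = - q_mu q"
| "q_nu (qcnj q) = - q_nu q"
| "q_eta (qcnj q) = - q_eta q"

instantiation quat :: real_inner
begin

definition inner_quat_def:
  "inner p q = q_re p * q_re q + q_mu p * q_mu q + q_nu p * q_nu q + q_eta p * q_eta q"

definition norm_quat_def:
  "norm q = sqrt ((q_re q)\<^sup>2 + (q_mu q)\<^sup>2 + (q_nu q)\<^sup>2 + (q_eta q)\<^sup>2)"

definition sgn_quat_def: "sgn (q::quat) = q /\<^sub>R norm q"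

definition dist_quat_def: "dist p q = norm (p - q :: quat)"

definition uniformity_quat_def [code del]:
  "(uniformity :: (quat \<times> quat) filter) = (INF e\<in>{0 <..}. principal {(p, q). dist p q < e})"

definition open_quat_def [code del]:
  "open (U :: quat set) \<longleftrightarrow> (\<forall>p\<in>U. eventually (\<lambda>(p', q). p' = p \<longrightarrow> q \<in> U) uniformity)"

instance
proof
  fix p q s :: quat and t :: real
  show "inner p q = inner q p"
    by (simp add: inner_quat_def mult.commute)
  show "inner (p + q) s = inner p s + inner q s" "inner (t *\<^sub>R p) q = t * inner p q"
    by (simp_all add: inner_quat_def algebra_simps)
  show "0 \<le> inner p p"
    by (simp add: inner_quat_def)
  show "inner p p = 0 \<longleftrightarrow> p = 0"
    by (simp add: inner_quat_def quat_eq_iff add_nonneg_eq_0_iff)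
  show "norm p = sqrt (inner p p)"
    by (simp add: norm_quat_def inner_quat_def power2_eq_square)
qed (rule sgn_quat_def dist_quat_def uniformity_quat_def open_quat_def)+

end

instantiation quat :: real_normed_div_algebra
begin

definition inverse_quat_def: "inverse q = qcnj q /\<^sub>R (norm q)\<^sup>2" for q :: quat

definition divide_quat_def: "p div q = p * inverse q" for p q :: quat

instance
proof
  fix p q :: quat
  have norm2: "(norm p)\<^sup>2 = q_re p * q_re p + q_mu p * q_mu p + q_nu p * q_nu p + q_eta p * q_eta p"
    for p :: quat
    by (simp add: norm_quat_def power2_eq_square [symmetric])
  have left: "qcnj p * p = (norm p)\<^sup>2 *\<^sub>R 1" and right: "p * qcnj p = (norm p)\<^sup>2 *\<^sub>R 1" for p
    by (simp_all add: quat_eq_iff norm2)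
  show "inverse p * p = 1" "p * inverse p = 1" if "p \<noteq> 0"
    using that by (simp_all add: inverse_quat_def left right)
  show "p div q = p * inverse q"
    by (rule divide_quat_def)
  show "inverse (0::quat) = 0"
    by (simp add: inverse_quat_def)
  have "qcnj (p * q) = qcnj q * qcnj p"
    by (simp add: quat_eq_iff)
  then have "(p * q) * qcnj (p * q) = p * (q * qcnj q) * qcnj p"
    by (simp add: mult.assoc)
  then have "(norm (p * q))\<^sup>2 *\<^sub>R (1::quat) = ((norm q)\<^sup>2 * (norm p)\<^sup>2) *\<^sub>R 1"
    by (simp only: right mult_scaleR_left mult_scaleR_right mult_1_right scaleR_scaleR)
  then have "(norm (p * q))\<^sup>2 = (norm p * norm q)\<^sup>2"
    by (simp only: scaleR_cancel_right) (simp add: power_mult_distrib mult.commute)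
  moreover have "0 \<le> norm x" for x :: quat
    by (simp add: norm_quat_def)
  ultimately show "norm (p * q) = norm p * norm q"
    by (metis power2_eq_imp_eq mult_nonneg_nonneg)
qed

end

definition unit_mu :: quat where "unit_mu = Quat 0 1 0 0"
definition unit_nu :: quat where "unit_nu = Quat 0 0 1 0"
definition unit_eta :: quat where "unit_eta = Quat 0 0 0 1"

lemma quat_unit_relations:
  "unit_mu * unit_mu = -1" "unit_nu * unit_nu = -1" "unit_eta * unit_eta = -1"
  "unit_mu * unit_nu * unit_eta = -1"
  "unit_mu * unit_nu = unit_eta" "unit_nu * unit_mu = - unit_eta"
  by (simp_all add: quat_eq_iff unit_mu_def unit_nu_def unit_eta_def)

lemma quat_decomp:
  "q = of_real (q_re q) + q_mu q *\<^sub>R unit_mu + q_nu q *\<^sub>R unit_nu + q_eta q *\<^sub>R unit_eta"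
  by (simp add: quat_eq_iff unit_mu_def unit_nu_def unit_eta_def of_real_def)

text \<open>The Euclidean structure makes quaternion-valued functions Bochner integrable
  in the sense of the library.\<close>

instantiation quat :: euclidean_space
begin

definition Basis_quat_def: "Basis = {1, unit_mu, unit_nu, unit_eta}"

instance
proof
  have ne: "1 \<noteq> unit_mu" "1 \<noteq> unit_nu" "1 \<noteq> unit_eta"
    "unit_mu \<noteq> unit_nu" "unit_mu \<noteq> unit_eta" "unit_nu \<noteq> unit_eta"
    by (simp_all add: quat_eq_iff unit_mu_def unit_nu_def unit_eta_def)
  have sel: "inner x 1 = q_re x" "inner x unit_mu = q_mu x"
    "inner x unit_nu = q_nu x" "inner x unit_eta = q_eta x" for x
    by (simp_all add: inner_quat_def unit_mu_def unit_nu_def unit_eta_def)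
  show "(Basis :: quat set) \<noteq> {}" "finite (Basis :: quat set)"
    by (simp_all add: Basis_quat_def)
  show "inner u v = (if u = v then 1 else 0)" if "u \<in> Basis" "v \<in> Basis" for u v :: quat
    using that ne ne [symmetric] unfolding Basis_quat_def
    by (elim insertE emptyE) (simp_all add: sel, simp_all add: unit_mu_def unit_nu_def unit_eta_def)
  show "(\<forall>u\<in>Basis. inner x u = 0) \<longleftrightarrow> x = 0" for x :: quat
    by (simp add: Basis_quat_def sel quat_eq_iff)
qed

end


section \<open>The subfield H(mu) and its Lebesgue spaces\<close>

definition H_mu :: "quat set" where
  "H_mu = {of_real s + unit_mu * of_real t | s t. True}"

definition quat_of_complex :: "complex \<Rightarrow> quat" where
  "quat_of_complex z = of_real (Re z) + unit_mu * of_real (Im z)"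

text \<open>The principal square root, transported along the isomorphism of \<^term>\<open>H_mu\<close> with
  the complex numbers; only meaningful for arguments in \<^term>\<open>H_mu\<close>.\<close>

definition mu_sqrt :: "quat \<Rightarrow> quat" where
  "mu_sqrt q = quat_of_complex (csqrt (Complex (q_re q) (q_mu q)))"

definition Lp_mu :: "real \<Rightarrow> (real \<times> real \<Rightarrow> quat) set" where
  "Lp_mu p = {f. f \<in> borel_measurable lebesgue \<and> range f \<subseteq> H_mu \<and>
     (\<integral>\<^sup>+z. ennreal (norm (f z) powr p) \<partial>lebesgue) < \<infinity>}"


section \<open>The quaternion linear canonical transform\<close>

definition lct_kernel :: "real^2^2 \<Rightarrow> real \<Rightarrow> real \<Rightarrow> quat" where
  "lct_kernel A x u =
    (let a = A $ 1 $ 1; b = A $ 1 $ 2; d = A $ 2 $ 2 in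
       1 / mu_sqrt (of_real (2 * pi * b) * unit_mu) *
       exp (unit_mu * of_real (a / (2 * b) * x\<^sup>2 - 1 / b * x * u + d / (2 * b) * u\<^sup>2)))"

definition qlct ::
  "real^2^2 \<Rightarrow> real^2^2 \<Rightarrow> (real \<times> real \<Rightarrow> quat) \<Rightarrow> real \<times> real \<Rightarrow> quat" where
  "qlct A\<^sub>1 A\<^sub>2 f = (\<lambda>(u, v).
     \<integral>(x, y). lct_kernel A\<^sub>1 x u * f (x, y) * lct_kernel A\<^sub>2 y v \<partial>lebesgue)"

end

theory Submission
  imports Defs "HOL-Probability.Characteristic_Functions"
begin

text \<open>Inside \<^term>\<open>H_mu\<close> everything commutes, so the transform is, up to a scaling of the
  frequencies and multiplication by a function of constant modulus, the complex Fourier transform of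
  \<open>f\<close> multiplied by a unimodular chirp, and the same chirp occurs for \<open>r\<close>. The chirps cancel in
  both integrals, and the claim becomes Parseval's identity for two integrable functions, the first
  with integrable Fourier transform. By Fubini this follows from Fourier inversion almost
  everywhere, which is obtained from Gaussian regularisation: the regularised inverse transform is the
  convolution of the function with a Gaussian, and letting the width tend to 0 shows that the
  function and its inverse transform have the same integral over every box.\<close>

section \<open>Gaussian regularisation\<close>

lemma borel_measurable_cis [measurable]: "cis \<in> borel_measurable borel"
  by (intro borel_measurable_continuous_onI continuous_intros)

text \<open>The diagonal affine change of variables of a Euclidean space, read off in the basis
  \<open>(1, 0)\<close>, \<open>(0, 1)\<close>. The two factors may differ, as required by the
  frequency scaling with \<open>1 / b\<^sub>1\<close> and \<open>1 / b\<^sub>2\<close>.\<close>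

lemma lborel_affine_prod:
  fixes a b :: real and t :: "real \<times> real"
  assumes "a \<noteq> 0" "b \<noteq> 0"
  shows "lborel = density (distr lborel borel (\<lambda>x. t + (a * fst x, b * snd x))) (\<lambda>_. ennreal \<bar>a * b\<bar>)"
proof -
  define c :: "real \<times> real \<Rightarrow> real" where "c = (\<lambda>j. if j = (1, 0) then a else b)"
  have B: "(Basis :: (real \<times> real) set) = {(1, 0), (0, 1)}"
    by (auto simp: Basis_prod_def)
  have "(\<lambda>x. t + (\<Sum>j\<in>Basis. (c j * (x \<bullet> j)) *\<^sub>R j)) = (\<lambda>x. t + (a * fst x, b * snd x))"
    by (auto simp: B c_def inner_prod_def fun_eq_iff)
  moreover have "(\<Prod>j\<in>Basis. \<bar>c j\<bar>) = \<bar>a * b\<bar>"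
    by (simp add: B c_def abs_mult)
  ultimately show ?thesis
    using lborel_affine_euclidean[of c t] assms by (simp add: B c_def abs_mult ennreal_mult)
qed

lemma
  fixes a b :: real and t :: "real \<times> real" and f :: "real \<times> real \<Rightarrow> 'a :: {banach, second_countable_topology}"
  assumes "a \<noteq> 0" "b \<noteq> 0" and [measurable]: "f \<in> borel_measurable borel"
  shows integrable_affine_prod_iff:
      "integrable lborel (\<lambda>x. f (t + (a * fst x, b * snd x))) \<longleftrightarrow> integrable lborel f"
    and integral_affine_prod:
      "integral\<^sup>L lborel f = \<bar>a * b\<bar> *\<^sub>R (\<integral>x. f (t + (a * fst x, b * snd x)) \<partial>lborel)"
proof -
  have m [measurable]: "(\<lambda>x. t + (a * fst x, b * snd x)) \<in> borel_measurable borel"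
    by (intro borel_measurable_continuous_onI continuous_intros)
  have "integrable lborel f \<longleftrightarrow>
      integrable lborel (\<lambda>x. \<bar>a * b\<bar> *\<^sub>R f (t + (a * fst x, b * snd x)))"
    using assms
    by (subst lborel_affine_prod[of a b t]) (simp_all add: integrable_density integrable_distr_eq)
  then show "integrable lborel (\<lambda>x. f (t + (a * fst x, b * snd x))) \<longleftrightarrow> integrable lborel f"
    using assms integrable_scaleR_right[of "1 / \<bar>a * b\<bar>" lborel "\<lambda>x. \<bar>a * b\<bar> *\<^sub>R f (t + (a * fst x, b * snd x))"]
    by auto
  show "integral\<^sup>L lborel f = \<bar>a * b\<bar> *\<^sub>R (\<integral>x. f (t + (a * fst x, b * snd x)) \<partial>lborel)"
    using assms
    by (subst lborel_affine_prod[of a b t])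
       (simp_all add: integral_density integral_distr)
qed

text \<open>Fubini for separated variables; it reduces the Fourier integral of the planar Gaussian
  to two integrals over the line.\<close>

lemma has_bochner_integral_lborel_prod:
  fixes f :: "'a::euclidean_space \<Rightarrow> complex" and g :: "'b::euclidean_space \<Rightarrow> complex"
  assumes f: "integrable lborel f" and g: "integrable lborel g"
  shows "has_bochner_integral lborel (\<lambda>p. f (fst p) * g (snd p)) (integral\<^sup>L lborel f * integral\<^sup>L lborel g)"
proof -
  have [measurable]: "f \<in> borel_measurable borel" "g \<in> borel_measurable borel"
    using assms by (auto dest: borel_measurable_integrable)
  have i: "integrable (lborel \<Otimes>\<^sub>M lborel) (\<lambda>(x, y). f x * g y)"
    using f g by (intro lborel_pair.Fubini_integrable) (auto simp: norm_mult)
  have "(\<integral>p. f (fst p) * g (snd p) \<partial>(lborel \<Otimes>\<^sub>M lborel)) = integral\<^sup>L lborel f * integral\<^sup>L lborel g"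
    using lborel_pair.integral_fst[OF i] by (simp add: case_prod_unfold)
  with i show ?thesis
    by (simp add: has_bochner_integral_iff lborel_prod case_prod_unfold)
qed

section \<open>The standard normal density of the plane and its Fourier transform\<close>

definition gauss :: "real \<times> real \<Rightarrow> real" where
  "gauss p = exp (- (norm p)\<^sup>2 / 2) / (2 * pi)"

lemma gauss_measurable [measurable]: "gauss \<in> borel_measurable borel"
  unfolding gauss_def[abs_def] by measurable

lemma gauss_pos: "0 < gauss p"
  by (simp add: gauss_def)

lemma gauss_eq: "gauss p = std_normal_density (fst p) * std_normal_density (snd p)"
  by (cases p) (simp add: gauss_def std_normal_density_def norm_Pair exp_add[symmetric]
    add_divide_distrib[symmetric] field_simps)

text \<open>The density is a product of two standard normal densities on the line, each with
  characteristic function \<open>exp (- t\<^sup>2 / 2)\<close>. The factor \<open>2 * pi\<close>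
  makes up for the normalisation contained in \<open>gauss\<close>.\<close>

lemma fourier_gauss:
  "has_bochner_integral lborel (\<lambda>\<xi>. cis (\<xi> \<bullet> s) * gauss \<xi>) (2 * pi * gauss s)"
proof -
  have i: "integrable lborel (\<lambda>x. cis (x * t) * std_normal_density x)" for t :: real
    by (rule Bochner_Integration.integrable_bound[OF integrable_normal_density[of 1 0]])
       (auto simp: norm_mult)
  have v: "(\<integral>x. cis (x * t) * std_normal_density x \<partial>lborel) = exp (- (t\<^sup>2) / 2)" for t :: real
    using fun_cong[OF char_std_normal_distribution, of t]
    by (simp add: char_def integral_density normal_density_nonneg cis_conv_exp scaleR_conv_of_real mult_ac)
  have "has_bochner_integral lborel
      (\<lambda>p. (cis (fst p * fst s) * std_normal_density (fst p)) * (cis (snd p * snd s) * std_normal_density (snd p)))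
      (exp (- ((fst s)\<^sup>2) / 2) * exp (- ((snd s)\<^sup>2) / 2))"
    using has_bochner_integral_lborel_prod[OF i[of "fst s"] i[of "snd s"]] unfolding v by simp
  also have "exp (- ((fst s)\<^sup>2) / 2) * exp (- ((snd s)\<^sup>2) / 2) = 2 * pi * gauss s"
    by (cases s) (simp add: gauss_def norm_Pair exp_add[symmetric] field_simps)
  finally show ?thesis
    by (simp add: gauss_eq inner_prod_def cis_mult[symmetric] mult_ac)
qed

text \<open>The total mass is the Fourier transform at frequency 0, where
  \<open>2 * pi * gauss 0 = 1\<close>.\<close>

lemma has_bochner_integral_gauss: "has_bochner_integral lborel gauss 1"
proof -
  have "has_bochner_integral lborel (\<lambda>\<xi>. Re (cis (\<xi> \<bullet> 0) * gauss \<xi>)) (Re (2 * pi * gauss 0))"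
    by (intro has_bochner_integral_Re fourier_gauss)
  then show ?thesis by (simp add: gauss_def[abs_def])
qed

text \<open>Substituting \<open>e *\<^sub>R \<xi>\<close> in \<open>fourier_gauss\<close>. The
  unnormalised Gaussian on the left is the weight that regularises the inverse transform; on the
  right stands \<open>(2 * pi)\<^sup>2\<close> times an approximate identity of width
  \<open>e\<close>.\<close>

lemma fourier_gauss_scaled:
  assumes e: "e > 0"
  shows "has_bochner_integral lborel (\<lambda>\<xi>. cis (\<xi> \<bullet> s) * exp (- (norm (e *\<^sub>R \<xi>))\<^sup>2 / 2))
    ((2 * pi)\<^sup>2 * (gauss (s /\<^sub>R e) / e\<^sup>2))"
proof -
  define h where "h = (\<lambda>\<xi>. cis (\<xi> \<bullet> s) * exp (- (norm (e *\<^sub>R \<xi>))\<^sup>2 / 2))"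
  let ?f = "\<lambda>\<xi>. cis (\<xi> \<bullet> (s /\<^sub>R e)) * gauss \<xi>"
  have [measurable]: "?f \<in> borel_measurable borel"
    by measurable
  have fg: "integrable lborel ?f" "integral\<^sup>L lborel ?f = 2 * pi * gauss (s /\<^sub>R e)"
    using fourier_gauss[of "s /\<^sub>R e"] unfolding has_bochner_integral_iff by blast+
  have eq: "?f (0 + (e * fst \<xi>, e * snd \<xi>)) = h \<xi> / (2 * pi)" for \<xi>
  proof -
    have "0 + (e * fst \<xi>, e * snd \<xi>) = e *\<^sub>R \<xi>" by (cases \<xi>) simp
    moreover have "(e *\<^sub>R \<xi>) \<bullet> (s /\<^sub>R e) = \<xi> \<bullet> s" using e by simp
    ultimately show ?thesis by (simp only: gauss_def h_def) simp
  qed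
  have "integrable lborel (\<lambda>\<xi>. ?f (0 + (e * fst \<xi>, e * snd \<xi>)))"
    by (subst integrable_affine_prod_iff) (use e fg in simp_all)
  moreover have "2 * pi * gauss (s /\<^sub>R e) = \<bar>e * e\<bar> *\<^sub>R (\<integral>\<xi>. ?f (0 + (e * fst \<xi>, e * snd \<xi>)) \<partial>lborel)"
    by (subst integral_affine_prod[symmetric]) (use e fg in simp_all)
  ultimately have "integrable lborel (\<lambda>\<xi>. h \<xi> / (2 * pi))"
      and "2 * pi * gauss (s /\<^sub>R e) = e\<^sup>2 * (integral\<^sup>L lborel h / (2 * pi))"
    unfolding eq h_def[symmetric] by (simp_all add: scaleR_conv_of_real power2_eq_square)
  then have "integrable lborel h" "integral\<^sup>L lborel h = (2 * pi)\<^sup>2 * (gauss (s /\<^sub>R e) / e\<^sup>2)"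
    using e integrable_mult_right[of "complex_of_real (2 * pi)" lborel "\<lambda>\<xi>. h \<xi> / (2 * pi)"]
    by (simp_all add: field_simps power2_eq_square)
  then show ?thesis
    by (simp add: has_bochner_integral_iff h_def)
qed

section \<open>The Fourier transform, without normalising factor, and its Gaussian
  regularisation\<close>

definition ft :: "(real \<times> real \<Rightarrow> complex) \<Rightarrow> real \<times> real \<Rightarrow> complex" where
  "ft F \<xi> = (\<integral>x. cis (- (x \<bullet> \<xi>)) * F x \<partial>lborel)"

lemma borel_measurable_ft [measurable]:
  assumes [measurable]: "F \<in> borel_measurable borel"
  shows "ft F \<in> borel_measurable borel"
  unfolding ft_def[abs_def] by measurable

lemma integrable_cis_mult:
  fixes F :: "'a \<Rightarrow> complex"
  assumes "integrable M F" and [measurable]: "h \<in> borel_measurable M"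
  shows "integrable M (\<lambda>x. cis (h x) * F x)"
  by (rule Bochner_Integration.integrable_bound[OF assms(1)])
     (use assms(1) in \<open>auto simp: norm_mult\<close>)

text \<open>The weight decays fast enough for Fubini although only \<open>F\<close> is assumed
  integrable. Once the order is exchanged, the inner integral over \<xi> is
  \<open>fourier_gauss_scaled\<close> at \<open>a - x\<close>, so the regularised inverse transform
  is a convolution with a Gaussian.\<close>

lemma ft_gauss_mean:
  fixes F :: "real \<times> real \<Rightarrow> complex"
  assumes F: "integrable lborel F" and e: "e > 0"
  shows "(\<integral>\<xi>. cis (\<xi> \<bullet> a) * ft F \<xi> * exp (- (norm (e *\<^sub>R \<xi>))\<^sup>2 / 2) \<partial>lborel) =
    (2 * pi)\<^sup>2 * (\<integral>x. F x * (gauss ((a - x) /\<^sub>R e) / e\<^sup>2) \<partial>lborel)"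
proof -
  have [measurable]: "F \<in> borel_measurable borel"
    using F by (auto dest: borel_measurable_integrable)
  let ?w = "\<lambda>\<xi>::real\<times>real. exp (- (norm (e *\<^sub>R \<xi>))\<^sup>2 / 2)"
  let ?h = "\<lambda>x \<xi>. F x * (cis (\<xi> \<bullet> (a - x)) * ?w \<xi>)"
  have g: "integrable lborel (\<lambda>\<xi>. cis (\<xi> \<bullet> s) * ?w \<xi>)"
      "(\<integral>\<xi>. cis (\<xi> \<bullet> s) * ?w \<xi> \<partial>lborel) = (2 * pi)\<^sup>2 * (gauss (s /\<^sub>R e) / e\<^sup>2)" for s
    using fourier_gauss_scaled[OF e, of s] unfolding has_bochner_integral_iff by blast+
  have i: "integrable (lborel \<Otimes>\<^sub>M lborel) (\<lambda>(x, \<xi>). ?h x \<xi>)"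
    using F g(1) by (intro lborel_pair.Fubini_integrable) (auto simp: norm_mult)
  have "(\<integral>\<xi>. cis (\<xi> \<bullet> a) * ft F \<xi> * ?w \<xi> \<partial>lborel) = (\<integral>\<xi>. (\<integral>x. ?h x \<xi> \<partial>lborel) \<partial>lborel)"
  proof (rule Bochner_Integration.integral_cong[OF refl])
    fix \<xi> :: "real \<times> real"
    have "cis (\<xi> \<bullet> a) * ft F \<xi> * ?w \<xi> = (\<integral>x. cis (\<xi> \<bullet> a) * (cis (- (x \<bullet> \<xi>)) * F x) * ?w \<xi> \<partial>lborel)"
      unfolding ft_def by simp
    also have "\<dots> = (\<integral>x. ?h x \<xi> \<partial>lborel)"
    proof (rule Bochner_Integration.integral_cong[OF refl])
      fix x :: "real \<times> real"
      have "cis (\<xi> \<bullet> a) * (cis (- (x \<bullet> \<xi>)) * F x) * ?w \<xi> =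
          F x * ((cis (\<xi> \<bullet> a) * cis (- (x \<bullet> \<xi>))) * ?w \<xi>)"
        by (simp only: mult_ac)
      also have "cis (\<xi> \<bullet> a) * cis (- (x \<bullet> \<xi>)) = cis (\<xi> \<bullet> (a - x))"
        by (simp add: cis_mult inner_diff_right inner_commute)
      finally show "cis (\<xi> \<bullet> a) * (cis (- (x \<bullet> \<xi>)) * F x) * ?w \<xi> = ?h x \<xi>" .
    qed
    finally show "cis (\<xi> \<bullet> a) * ft F \<xi> * ?w \<xi> = (\<integral>x. ?h x \<xi> \<partial>lborel)" .
  qed
  also have "\<dots> = (\<integral>x. (\<integral>\<xi>. ?h x \<xi> \<partial>lborel) \<partial>lborel)"
    by (rule lborel_pair.Fubini_integral[OF i])
  also have "\<dots> = (\<integral>x. (2 * pi)\<^sup>2 * (F x * (gauss ((a - x) /\<^sub>R e) / e\<^sup>2)) \<partial>lborel)"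
    unfolding integral_mult_right_zero g(2) by (simp only: of_real_mult mult_ac flip: integral_mult_right_zero)
  finally show ?thesis
    by simp
qed

text \<open>Substituting \<open>a = x + e *\<^sub>R z\<close> turns the narrow Gaussian at
  \<open>x\<close> into the standard one, the Jacobian \<open>e\<^sup>2\<close> cancelling the
  denominator. Integrability follows by domination with \<open>C * gauss z\<close>.\<close>

lemma
  fixes \<phi> :: "real \<times> real \<Rightarrow> complex"
  assumes [measurable]: "\<phi> \<in> borel_measurable borel" and b: "\<And>x. norm (\<phi> x) \<le> C" and e: "e > 0"
  shows integrable_gauss_kernel: "integrable lborel (\<lambda>a. \<phi> a * (gauss ((a - x) /\<^sub>R e) / e\<^sup>2))"
    and integral_gauss_kernel: "(\<integral>a. \<phi> a * (gauss ((a - x) /\<^sub>R e) / e\<^sup>2) \<partial>lborel) =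
      (\<integral>z. \<phi> (x + e *\<^sub>R z) * gauss z \<partial>lborel)"
proof -
  let ?f = "\<lambda>a. \<phi> a * (gauss ((a - x) /\<^sub>R e) / e\<^sup>2)"
  have eq: "?f (x + (e * fst z, e * snd z)) = \<phi> (x + e *\<^sub>R z) * gauss z / e\<^sup>2" for z
  proof -
    have "(e * fst z, e * snd z) = e *\<^sub>R z" by (cases z) simp
    with e show ?thesis by simp
  qed
  have "integrable lborel (\<lambda>z. C * gauss z)"
    using has_bochner_integral_gauss by (auto simp: has_bochner_integral_iff)
  then have "integrable lborel (\<lambda>z. \<phi> (x + e *\<^sub>R z) * gauss z)"
  proof (rule Bochner_Integration.integrable_bound)
    have "norm (\<phi> (x + e *\<^sub>R z) * gauss z) \<le> norm (C * gauss z)" for z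
    proof -
      have "norm (\<phi> (x + e *\<^sub>R z)) * gauss z \<le> C * gauss z"
        by (intro mult_right_mono b less_imp_le[OF gauss_pos])
      also have "\<dots> \<le> \<bar>C * gauss z\<bar>" by simp
      finally show ?thesis by (simp add: norm_mult abs_of_pos[OF gauss_pos])
    qed
    then show "AE z in lborel. norm (\<phi> (x + e *\<^sub>R z) * gauss z) \<le> norm (C * gauss z)"
      by simp
  qed measurable
  then have "integrable lborel (\<lambda>z. ?f (x + (e * fst z, e * snd z)))"
    unfolding eq by simp
  then show "integrable lborel ?f"
    using e by (subst (asm) integrable_affine_prod_iff) simp_all
  have "integral\<^sup>L lborel ?f = \<bar>e * e\<bar> *\<^sub>R (\<integral>z. ?f (x + (e * fst z, e * snd z)) \<partial>lborel)"
    using e by (intro integral_affine_prod) simp_all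
  then show "integral\<^sup>L lborel ?f = (\<integral>z. \<phi> (x + e *\<^sub>R z) * gauss z \<partial>lborel)"
    unfolding eq using e by (simp add: scaleR_conv_of_real power2_eq_square)
qed

text \<open>Fubini moves the Gaussian average from \<open>F\<close> to the bounded test function
  \<open>\<phi>\<close>. The kernel has mass 1 in \<open>a\<close>, so the inner integral of the
  absolute value is at most \<open>C * norm (F x)\<close>.\<close>

lemma gauss_mean_swap:
  fixes F \<phi> :: "real \<times> real \<Rightarrow> complex"
  assumes F: "integrable lborel F" and [measurable]: "\<phi> \<in> borel_measurable borel"
    and b: "\<And>x. norm (\<phi> x) \<le> C" and e: "e > 0"
  shows "(\<integral>a. \<phi> a * (\<integral>x. F x * (gauss ((a - x) /\<^sub>R e) / e\<^sup>2) \<partial>lborel) \<partial>lborel) =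
    (\<integral>x. F x * (\<integral>z. \<phi> (x + e *\<^sub>R z) * gauss z \<partial>lborel) \<partial>lborel)"
proof -
  have [measurable]: "F \<in> borel_measurable borel"
    using F by (auto dest: borel_measurable_integrable)
  have g1: "integral\<^sup>L lborel gauss = 1" "integrable lborel gauss"
    using has_bochner_integral_gauss by (auto simp: has_bochner_integral_iff)
  let ?k = "\<lambda>a x. gauss ((a - x) /\<^sub>R e) / e\<^sup>2"
  have C: "0 \<le> C" using norm_ge_zero b order_trans by blast
  have i: "integrable (lborel \<Otimes>\<^sub>M lborel) (\<lambda>(x, a). F x * (\<phi> a * ?k a x))"
  proof (rule lborel_pair.Fubini_integrable)
    define I where "I x = (\<integral>a. norm (\<phi> a * ?k a x) \<partial>lborel)" for x
    have [measurable]: "I \<in> borel_measurable borel"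
      unfolding I_def[abs_def] by measurable
    have "integrable lborel (\<lambda>x. norm (F x) * I x)"
    proof (rule Bochner_Integration.integrable_bound)
      show "integrable lborel (\<lambda>x. C * F x)" using F by simp
      have le: "(\<integral>a. norm (\<phi> a * ?k a x) \<partial>lborel) \<le> C" for x
      proof -
        \<comment> \<open>The kernel lemma concerns complex functions, so it is applied to
          \<open>norm (\<phi> a)\<close> regarded as a complex number.\<close>
        have j: "complex_of_real (\<integral>a. norm (\<phi> a * ?k a x) \<partial>lborel) =
            (\<integral>a. complex_of_real (norm (\<phi> a)) * ?k a x \<partial>lborel)"
          unfolding integral_complex_of_real[symmetric]
          by (intro Bochner_Integration.integral_cong refl)
             (simp add: norm_mult norm_divide norm_power abs_of_pos[OF gauss_pos])
        also have "\<dots> = (\<integral>z. complex_of_real (norm (\<phi> (x + e *\<^sub>R z))) * gauss z \<partial>lborel)"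
          by (rule integral_gauss_kernel[OF _ _ e, where C = C]) (use b in simp_all)
        also have "\<dots> = of_real (\<integral>z. norm (\<phi> (x + e *\<^sub>R z)) * gauss z \<partial>lborel)"
          by (subst integral_complex_of_real[symmetric]) simp
        finally have "(\<integral>a. norm (\<phi> a * ?k a x) \<partial>lborel) = (\<integral>z. norm (\<phi> (x + e *\<^sub>R z)) * gauss z \<partial>lborel)"
          by (simp only: of_real_eq_iff)
        also have "\<dots> \<le> (\<integral>z. C * gauss z \<partial>lborel)"
          by (rule integral_mono') (use g1 C less_imp_le[OF gauss_pos] in \<open>simp_all add: mult_right_mono b\<close>)
        finally show ?thesis using g1 by simp
      qed
      have I: "norm (norm (F x) * I x) \<le> norm (C * F x)" for x
      proof -
        have "0 \<le> I x" unfolding I_def by (rule Bochner_Integration.integral_nonneg) simp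
        moreover have "I x \<le> C" unfolding I_def
          by (rule le)
        ultimately show ?thesis
          using C by (simp add: norm_mult abs_mult mult.commute[of C] mult_left_mono)
      qed
      show "AE x in lborel. norm (norm (F x) * I x) \<le> norm (C * F x)"
        using I by (intro always_eventually allI)
    qed measurable
    then show "integrable lborel (\<lambda>x. \<integral>a. norm (case (x, a) of (x, a) \<Rightarrow> F x * (\<phi> a * ?k a x)) \<partial>lborel)"
      unfolding I_def by (simp only: split norm_mult[of "F _"] integral_mult_right_zero)
    show "AE x in lborel. integrable lborel (\<lambda>a. case (x, a) of (x, a) \<Rightarrow> F x * (\<phi> a * ?k a x))"
      unfolding split
      by (intro always_eventually allI integrable_mult_right integrable_gauss_kernel[OF _ b e]) measurable
  qed measurable
  have "(\<integral>a. \<phi> a * (\<integral>x. F x * ?k a x \<partial>lborel) \<partial>lborel) = (\<integral>a. (\<integral>x. F x * (\<phi> a * ?k a x) \<partial>lborel) \<partial>lborel)"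
    by (subst integral_mult_right_zero[symmetric]) (simp add: mult_ac)
  also have "\<dots> = (\<integral>x. (\<integral>a. F x * (\<phi> a * ?k a x) \<partial>lborel) \<partial>lborel)"
    by (rule lborel_pair.Fubini_integral[OF i])
  also have "\<dots> = (\<integral>x. F x * (\<integral>a. \<phi> a * ?k a x \<partial>lborel) \<partial>lborel)"
    by simp
  also have "\<dots> = (\<integral>x. F x * (\<integral>z. \<phi> (x + e *\<^sub>R z) * gauss z \<partial>lborel) \<partial>lborel)"
    by (subst integral_gauss_kernel[OF _ b e]) simp_all
  finally show ?thesis .
qed

section \<open>Fourier inversion and Parseval identity\<close>

text \<open>The positive and negative parts of \<open>k\<close> are densities of two measures that
  agree and are finite on boxes. Boxes are stable under intersection, generate the Borel sets and
  exhaust the space, so the measures coincide, and with them the densities almost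
  everywhere.\<close>

lemma AE_eq_0_if_box_integrals_0:
  fixes k :: "'a::euclidean_space \<Rightarrow> real"
  assumes [measurable]: "k \<in> borel_measurable borel"
    and int: "\<And>l u. integrable lborel (\<lambda>x. indicator (box l u) x * k x)"
    and zero: "\<And>l u. (\<integral>x. indicator (box l u) x * k x \<partial>lborel) = 0"
  shows "AE x in lborel. k x = 0"
proof -
  let ?P = "density lborel (\<lambda>x. ennreal (k x))" and ?N = "density lborel (\<lambda>x. ennreal (- k x))"
  have em: "emeasure ?P (box l u) = emeasure ?N (box l u)" "emeasure ?P (box l u) \<noteq> \<infinity>" for l u :: 'a
  proof -
    let ?h = "\<lambda>x. indicator (box l u) x * k x"
    have "emeasure ?P (box l u) = (\<integral>\<^sup>+x. ennreal (?h x) \<partial>lborel)"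
         "emeasure ?N (box l u) = (\<integral>\<^sup>+x. ennreal (- ?h x) \<partial>lborel)"
      by (auto simp: emeasure_density intro!: nn_integral_cong split: split_indicator)
    \<comment> \<open>Integrability makes the integrals \<open>r\<close> and \<open>q\<close> of the
      two parts finite, and the vanishing of \<open>r - q\<close> makes them equal.\<close>
    moreover obtain r q where "0 \<le> r" "0 \<le> q" "(\<integral>\<^sup>+x. ennreal (?h x) \<partial>lborel) = ennreal r"
        "(\<integral>\<^sup>+x. ennreal (- ?h x) \<partial>lborel) = ennreal q"
        "?h \<in> borel_measurable lborel" "(\<integral>x. ?h x \<partial>lborel) = r - q"
      by (rule integrableE[OF int[of l u]])
    ultimately show "emeasure ?P (box l u) = emeasure ?N (box l u)" "emeasure ?P (box l u) \<noteq> \<infinity>"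
      using zero[of l u] by simp_all
  qed
  have "?P = ?N"
  proof (rule measure_eqI_generator_eq)
    let ?E = "range (\<lambda>(a, b). box a b::'a set)"
    show "Int_stable ?E"
      by (auto simp: Int_stable_def box_Int_box)
    show "?E \<subseteq> Pow UNIV" "sets ?P = sigma_sets UNIV ?E" "sets ?N = sigma_sets UNIV ?E"
      by (simp_all add: borel_eq_box)
    let ?A = "\<lambda>n::nat. box (- (real n *\<^sub>R One)) (real n *\<^sub>R One) :: 'a set"
    show "range ?A \<subseteq> ?E" "(\<Union>i. ?A i) = UNIV"
      unfolding UN_box_eq_UNIV by auto
    show "emeasure ?P (?A i) \<noteq> \<infinity>" for i
      by (rule em(2))
    show "emeasure ?P X = emeasure ?N X" if "X \<in> ?E" for X
      using that em(1) by auto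
  qed
  then have "AE x in lborel. ennreal (k x) = ennreal (- k x)"
    by (intro sigma_finite_measure.density_unique[OF sigma_finite_lborel]) auto
  then show ?thesis
  proof eventually_elim
    case (elim x)
    then show ?case
      \<comment> \<open>\<open>ennreal\<close> sends negative reals to 0, so for nonzero
        \<open>k x\<close> exactly one of the two sides would vanish.\<close>
      by (cases "k x" "0::real" rule: linorder_cases) (auto simp: ennreal_neg ennreal_eq_0_iff dest: sym)
  qed
qed

text \<open>Off the frontier the indicator is locally constant, so for each \<open>z\<close> the
  integrand is eventually constant in \<open>n\<close>. Dominated convergence with
  \<open>gauss\<close>, which has mass 1, gives the limit.\<close>

lemma gauss_mean_indicator_tendsto:
  fixes S :: "(real \<times> real) set"
  assumes [measurable]: "S \<in> sets borel" and x: "x \<notin> frontier S" and e: "e \<longlonglongrightarrow> 0"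
  shows "(\<lambda>n. \<integral>z. indicator S (x + e n *\<^sub>R z) * complex_of_real (gauss z) \<partial>lborel) \<longlonglongrightarrow> indicator S x"
proof -
  have g: "has_bochner_integral lborel gauss 1"
    by (rule has_bochner_integral_gauss)
  have "(\<lambda>n. \<integral>z. indicator S (x + e n *\<^sub>R z) * complex_of_real (gauss z) \<partial>lborel)
      \<longlonglongrightarrow> (\<integral>z. indicator S x * complex_of_real (gauss z) \<partial>lborel)"
  proof (rule integral_dominated_convergence[where w = gauss])
    have "eventually (\<lambda>n. (indicator S (x + e n *\<^sub>R z) :: complex) = indicator S x) sequentially" for z
    proof -
      have "(\<lambda>n. x + e n *\<^sub>R z) \<longlonglongrightarrow> x + 0 *\<^sub>R z"
        by (intro tendsto_intros e)
      then have *: "(\<lambda>n. x + e n *\<^sub>R z) \<longlonglongrightarrow> x" by simp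
      consider "x \<in> interior S" | "x \<in> - closure S"
        using x by (auto simp: frontier_def)
      then show ?thesis
      proof cases
        case 1
        from topological_tendstoD[OF * open_interior 1] show ?thesis
          by (rule eventually_mono) (use 1 interior_subset in \<open>auto simp: indicator_def\<close>)
      next
        case 2
        have "open (- closure S)" by auto
        from topological_tendstoD[OF * this 2] show ?thesis
          by (rule eventually_mono) (use 2 closure_subset in \<open>auto simp: indicator_def\<close>)
      qed
    qed
    then have "(\<lambda>n. indicator S (x + e n *\<^sub>R z) * complex_of_real (gauss z))
        \<longlonglongrightarrow> indicator S x * complex_of_real (gauss z)" for z
      by (intro tendsto_mult tendsto_const) (rule tendsto_eventually)
    then show "AE z in lborel. (\<lambda>n. indicator S (x + e n *\<^sub>R z) * complex_of_real (gauss z))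
        \<longlonglongrightarrow> indicator S x * complex_of_real (gauss z)"
      by simp
    show "integrable lborel gauss"
      using g by (simp add: has_bochner_integral_iff)
  qed (auto simp: norm_mult abs_of_pos[OF gauss_pos] less_imp_le[OF gauss_pos] split: split_indicator)
  also have "(\<integral>z. indicator S x * complex_of_real (gauss z) \<partial>lborel) = indicator S x"
    using g by (simp add: has_bochner_integral_iff)
  finally show ?thesis .
qed

section \<open>Fourier inversion almost everywhere\<close>

lemma norm_ft_le:
  fixes F :: "real \<times> real \<Rightarrow> complex"
  shows "norm (ft F \<xi>) \<le> (\<integral>x. norm (F x) \<partial>lborel)"
  unfolding ft_def by (rule order_trans[OF integral_norm_bound]) (simp add: norm_mult)

text \<open>The regularised inverse transforms, integrated over the box, form a sequence
  \<open>X\<close> whose limit is computed twice: on the frequency side, where the weights tend to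
  1, and on the space side, where Gaussian averages of the box indicator tend to that indicator
  almost everywhere.\<close>

lemma ft_inversion_box:
  fixes F :: "real \<times> real \<Rightarrow> complex"
  assumes F: "integrable lborel F" and G: "integrable lborel (ft F)"
  shows "(\<integral>a. indicator (box l u) a * (ft (ft F) (- a) / (2 * pi)\<^sup>2) \<partial>lborel) =
    (\<integral>a. indicator (box l u) a * F a \<partial>lborel)"
proof (rule LIMSEQ_unique)
  have [measurable]: "F \<in> borel_measurable borel"
    using F by (auto dest: borel_measurable_integrable)
  let ?I = "indicator (box l u) :: _ \<Rightarrow> complex"
  define e :: "nat \<Rightarrow> real" where "e n = 1 / Suc n" for n
  have e: "e n > 0" "e \<longlonglongrightarrow> 0" for n
    unfolding e_def[abs_def] by (simp, rule LIMSEQ_Suc[OF lim_1_over_n])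
  define w where "w n \<xi> = exp (- (norm (e n *\<^sub>R \<xi>))\<^sup>2 / 2)" for n and \<xi> :: "real \<times> real"
  have w: "0 < w n \<xi>" "w n \<xi> \<le> 1" "(\<lambda>n. w n \<xi>) \<longlonglongrightarrow> 1" for n \<xi>
  proof -
    have "(\<lambda>n. w n \<xi>) \<longlonglongrightarrow> exp (- (norm (0 *\<^sub>R \<xi>))\<^sup>2 / 2)"
      unfolding w_def by (intro tendsto_intros e) simp
    then show "(\<lambda>n. w n \<xi>) \<longlonglongrightarrow> 1" by simp
  qed (simp_all add: w_def)
  have [measurable]: "w n \<in> borel_measurable borel" for n
    unfolding w_def[abs_def] by measurable
  define T where "T n a = (\<integral>\<xi>. cis (\<xi> \<bullet> a) * ft F \<xi> * w n \<xi> \<partial>lborel)" for n a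
  have [measurable]: "T n \<in> borel_measurable borel" for n
    unfolding T_def[abs_def] by measurable
  define X where "X n = (\<integral>a. ?I a * (T n a / (2 * pi)\<^sup>2) \<partial>lborel)" for n
  let ?C = "\<integral>\<xi>. norm (ft F \<xi>) \<partial>lborel"
  \<comment> \<open>This bound is uniform in \<open>n\<close> and \<open>a\<close>; as the box has
    finite measure, a multiple of its indicator dominates the integrands of
    \<open>X\<close>.\<close>
  have T_le: "norm (T n a) \<le> ?C" for n a
    unfolding T_def
    by (rule order_trans[OF integral_norm_bound], rule integral_mono')
       (use G w(1,2) in \<open>auto simp: norm_mult abs_of_pos intro!: mult_left_le\<close>)
  \<comment> \<open>Evaluation at \<open>- a\<close> reverses the sign of the phase, so
    \<open>ft (ft F) (- a)\<close> is the inverse transform up to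
    \<open>(2 * pi)\<^sup>2\<close>.\<close>
  have T_lim: "(\<lambda>n. T n a) \<longlonglongrightarrow> ft (ft F) (- a)" for a
    unfolding T_def ft_def[of "ft F" "- a"]
  proof (rule integral_dominated_convergence[where w = "\<lambda>\<xi>. norm (ft F \<xi>)"])
    have "(\<lambda>n. cis (\<xi> \<bullet> a) * ft F \<xi> * w n \<xi>) \<longlonglongrightarrow> cis (\<xi> \<bullet> a) * ft F \<xi> * of_real 1" for \<xi>
      by (intro tendsto_intros w)
    then show "AE \<xi> in lborel. (\<lambda>n. cis (\<xi> \<bullet> a) * ft F \<xi> * w n \<xi>) \<longlonglongrightarrow> cis (- (\<xi> \<bullet> - a)) * ft F \<xi>"
      by simp
    show "AE \<xi> in lborel. norm (cis (\<xi> \<bullet> a) * ft F \<xi> * w n \<xi>) \<le> norm (ft F \<xi>)" for n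
      using w(1,2) by (auto simp: norm_mult abs_of_pos intro!: mult_left_le)
  qed (use G in \<open>auto intro: integrable_norm\<close>)
  show "X \<longlonglongrightarrow> (\<integral>a. ?I a * (ft (ft F) (- a) / (2 * pi)\<^sup>2) \<partial>lborel)"
    unfolding X_def[abs_def]
  proof (rule integral_dominated_convergence[where w = "\<lambda>a. indicator (box l u) a * (?C / (2 * pi)\<^sup>2)"])
    show "integrable lborel (\<lambda>a. indicator (box l u) a * (?C / (2 * pi)\<^sup>2))"
      by (intro integrable_mult_left integrable_real_indicator) (simp_all add: emeasure_lborel_box_eq)
    show "AE a in lborel. norm (?I a * (T n a / (2 * pi)\<^sup>2)) \<le> indicator (box l u) a * (?C / (2 * pi)\<^sup>2)" for n
      using T_le by (auto simp: norm_mult norm_divide norm_power divide_right_mono split: split_indicator)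
    show "AE a in lborel. (\<lambda>n. ?I a * (T n a / (2 * pi)\<^sup>2)) \<longlonglongrightarrow> ?I a * (ft (ft F) (- a) / (2 * pi)\<^sup>2)"
      by (intro always_eventually allI tendsto_intros T_lim) simp
  qed measurable
  \<comment> \<open>The convolution form of \<open>T n\<close> allows the averaging to be moved from
    \<open>F\<close> to the indicator.\<close>
  have X: "X n = (\<integral>x. F x * (\<integral>z. ?I (x + e n *\<^sub>R z) * gauss z \<partial>lborel) \<partial>lborel)" for n
  proof -
    have "T n a / (2 * pi)\<^sup>2 = (\<integral>x. F x * (gauss ((a - x) /\<^sub>R e n) / (e n)\<^sup>2) \<partial>lborel)" for a
      unfolding T_def w_def ft_gauss_mean[OF F e(1)] by simp
    then have "X n = (\<integral>a. ?I a * (\<integral>x. F x * (gauss ((a - x) /\<^sub>R e n) / (e n)\<^sup>2) \<partial>lborel) \<partial>lborel)"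
      unfolding X_def by simp
    also have "\<dots> = (\<integral>x. F x * (\<integral>z. ?I (x + e n *\<^sub>R z) * gauss z \<partial>lborel) \<partial>lborel)"
      by (rule gauss_mean_swap[OF F _ _ e(1), where C = 1]) (auto split: split_indicator)
    finally show ?thesis .
  qed
  have "X \<longlonglongrightarrow> (\<integral>x. F x * ?I x \<partial>lborel)"
    unfolding X
  proof (rule integral_dominated_convergence[where w = "\<lambda>x. norm (F x)"])
    \<comment> \<open>The points at which the averages may fail to converge lie on the frontier of a
      convex set, hence in a null set.\<close>
    have "negligible (frontier (box l u))"
      by (intro negligible_convex_frontier convex_box)
    then have "AE x in lebesgue. x \<notin> frontier (box l u)"
      by (auto simp: negligible_iff_null_sets intro: AE_not_in)
    then have "AE x in lborel. x \<notin> frontier (box l u)"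
      by (simp add: AE_completion_iff)
    then show "AE x in lborel. (\<lambda>n. F x * (\<integral>z. ?I (x + e n *\<^sub>R z) * gauss z \<partial>lborel)) \<longlonglongrightarrow> F x * ?I x"
      by eventually_elim (intro tendsto_mult_left gauss_mean_indicator_tendsto e, simp_all)
    have "norm (\<integral>z. ?I (x + e n *\<^sub>R z) * gauss z \<partial>lborel) \<le> 1" for x n
    proof -
      have g: "integrable lborel gauss" "integral\<^sup>L lborel gauss = 1"
        using has_bochner_integral_gauss by (auto simp: has_bochner_integral_iff)
      have "norm (\<integral>z. ?I (x + e n *\<^sub>R z) * gauss z \<partial>lborel) \<le> (\<integral>z. gauss z \<partial>lborel)"
        by (rule order_trans[OF integral_norm_bound], rule integral_mono')
           (use g in \<open>auto simp: norm_mult abs_of_pos[OF gauss_pos] less_imp_le[OF gauss_pos] split: split_indicator\<close>)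
      with g show ?thesis by simp
    qed
    then show "AE x in lborel. norm (F x * (\<integral>z. ?I (x + e n *\<^sub>R z) * gauss z \<partial>lborel)) \<le> norm (F x)" for n
      by (auto simp: norm_mult intro!: always_eventually mult_left_le)
  qed (use F in \<open>auto intro: integrable_norm\<close>)
  then show "X \<longlonglongrightarrow> (\<integral>x. ?I x * F x \<partial>lborel)"
    by (simp add: mult.commute)
qed

text \<open>The difference \<open>D\<close> of the two sides has integral 0 over every box, so its
  real and imaginary parts vanish almost everywhere.\<close>

theorem ft_inversion_AE:
  fixes F :: "real \<times> real \<Rightarrow> complex"
  assumes F: "integrable lborel F" and G: "integrable lborel (ft F)"
  shows "AE a in lborel. F a = ft (ft F) (- a) / (2 * pi)\<^sup>2"
proof -
  have [measurable]: "F \<in> borel_measurable borel"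
    using F by (auto dest: borel_measurable_integrable)
  define H where "H a = ft (ft F) (- a) / (2 * pi)\<^sup>2" for a
  define D where "D a = F a - H a" for a
  have [measurable]: "H \<in> borel_measurable borel"
    unfolding H_def[abs_def] by measurable
  have [measurable]: "D \<in> borel_measurable borel"
    unfolding D_def[abs_def] by measurable
  let ?C = "(\<integral>\<xi>. norm (ft F \<xi>) \<partial>lborel) / (2 * pi)\<^sup>2"
  have C: "norm (H a) \<le> ?C" for a
    unfolding H_def using norm_ft_le[of "ft F" "- a"] by (simp add: norm_divide norm_power divide_right_mono)
  have 1: "integrable lborel (\<lambda>a. indicator (box l u) a * F a)" for l u
    by (rule Bochner_Integration.integrable_bound[OF F]) (auto split: split_indicator)
  \<comment> \<open>The inverse transform is bounded by \<open>?C\<close>, hence integrable over a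
    box.\<close>
  have 2: "integrable lborel (\<lambda>a. indicator (box l u) a * H a)" for l u
  proof (rule Bochner_Integration.integrable_bound)
    show "integrable lborel (\<lambda>a. indicator (box l u) a * ?C)"
      by (intro integrable_mult_left integrable_real_indicator) (simp_all add: emeasure_lborel_box_eq)
    show "AE a in lborel. norm (indicator (box l u) a * H a) \<le> norm (indicator (box l u) a * ?C)"
      using C order_trans[OF C abs_ge_self] by (auto split: split_indicator)
  qed measurable
  have D: "integrable lborel (\<lambda>a. indicator (box l u) a * D a)"
      "(\<integral>a. indicator (box l u) a * D a \<partial>lborel) = 0" for l u
    using 1[of l u] 2[of l u] ft_inversion_box[OF F G, of l u, folded H_def]
    by (simp_all add: D_def right_diff_distrib)
  have ReIm: "indicator (box l u) a * Re (D a) = Re (indicator (box l u) a * D a)"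
      "indicator (box l u) a * Im (D a) = Im (indicator (box l u) a * D a)" for l u a
    by (simp_all split: split_indicator)
  have "AE a in lborel. Re (D a) = 0"
  proof (rule AE_eq_0_if_box_integrals_0)
    show "integrable lborel (\<lambda>a. indicator (box l u) a * Re (D a))" for l u
      unfolding ReIm by (rule integrable_Re[OF D(1)])
    show "(\<integral>a. indicator (box l u) a * Re (D a) \<partial>lborel) = 0" for l u
      unfolding ReIm integral_Re[OF D(1)] D(2) by simp
  qed measurable
  moreover have "AE a in lborel. Im (D a) = 0"
  proof (rule AE_eq_0_if_box_integrals_0)
    show "integrable lborel (\<lambda>a. indicator (box l u) a * Im (D a))" for l u
      unfolding ReIm by (rule integrable_Im[OF D(1)])
    show "(\<integral>a. indicator (box l u) a * Im (D a) \<partial>lborel) = 0" for l u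
      unfolding ReIm integral_Im[OF D(1)] D(2) by simp
  qed measurable
  ultimately show ?thesis
    by eventually_elim (simp add: D_def H_def complex_eq_iff)
qed

section \<open>Parseval's identity\<close>

lemma borel_measurable_cnj [measurable]: "cnj \<in> borel_measurable borel"
  by (intro borel_measurable_continuous_onI continuous_intros)

text \<open>Both sides are iterated integrals of \<open>?h x \<xi>\<close>, which is absolutely
  integrable since \<open>ft F\<close> and \<open>R\<close> are. Integrating in \<open>x\<close>
  first produces \<open>cnj (ft R \<xi>)\<close>; integrating in \<xi> first produces
  \<open>F x\<close> by inversion.\<close>

theorem ft_parseval:
  fixes F R :: "real \<times> real \<Rightarrow> complex"
  assumes F: "integrable lborel F" and G: "integrable lborel (ft F)" and R: "integrable lborel R"
  shows "(\<integral>\<xi>. ft F \<xi> * cnj (ft R \<xi>) \<partial>lborel) = (2 * pi)\<^sup>2 * (\<integral>x. F x * cnj (R x) \<partial>lborel)"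
proof -
  have [measurable]: "F \<in> borel_measurable borel" "R \<in> borel_measurable borel"
    using F R by (auto dest: borel_measurable_integrable)
  let ?h = "\<lambda>x \<xi>. cis (\<xi> \<bullet> x) * ft F \<xi> * cnj (R x)"
  have i: "integrable (lborel \<Otimes>\<^sub>M lborel) (\<lambda>(x, \<xi>). ?h x \<xi>)"
    using G R by (intro lborel_pair.Fubini_integrable)
      (auto simp: norm_mult intro!: integrable_mult_left integrable_cis_mult)
  have "(\<integral>\<xi>. ft F \<xi> * cnj (ft R \<xi>) \<partial>lborel) = (\<integral>\<xi>. (\<integral>x. ?h x \<xi> \<partial>lborel) \<partial>lborel)"
  proof (rule Bochner_Integration.integral_cong[OF refl])
    fix \<xi> :: "real \<times> real"
    have "ft F \<xi> * cnj (ft R \<xi>) = (\<integral>x. ft F \<xi> * cnj (cis (- (x \<bullet> \<xi>)) * R x) \<partial>lborel)"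
      unfolding ft_def[of R] integral_mult_right_zero Bochner_Integration.integral_cnj ..
    also have "\<dots> = (\<integral>x. ?h x \<xi> \<partial>lborel)"
      by (simp add: cis_cnj inner_commute mult_ac)
    finally show "ft F \<xi> * cnj (ft R \<xi>) = (\<integral>x. ?h x \<xi> \<partial>lborel)" .
  qed
  also have "\<dots> = (\<integral>x. (\<integral>\<xi>. ?h x \<xi> \<partial>lborel) \<partial>lborel)"
    by (rule lborel_pair.Fubini_integral[OF i])
  also have "\<dots> = (\<integral>x. ft (ft F) (- x) * cnj (R x) \<partial>lborel)"
    by (simp add: ft_def[of "ft F"])
  also have "\<dots> = (\<integral>x. (2 * pi)\<^sup>2 * (F x * cnj (R x)) \<partial>lborel)"
    by (rule integral_cong_AE) (use ft_inversion_AE[OF F G] in \<open>auto simp: field_simps\<close>)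
  finally show ?thesis by simp
qed

section \<open>Transfer between complex numbers and quaternions\<close>

text \<open>Defined on all quaternions by dropping the nu and eta components, so that it is bounded
  linear everywhere; it inverts \<open>quat_of_complex\<close> on \<open>H_mu\<close>.\<close>

definition complex_of_quat :: "quat \<Rightarrow> complex" where
  "complex_of_quat q = Complex (q_re q) (q_mu q)"

lemma quat_of_complex_sel [simp]:
  "q_re (quat_of_complex z) = Re z" "q_mu (quat_of_complex z) = Im z"
  "q_nu (quat_of_complex z) = 0" "q_eta (quat_of_complex z) = 0"
  by (simp_all add: quat_of_complex_def unit_mu_def of_real_def)

lemma complex_of_quat_of_complex [simp]: "complex_of_quat (quat_of_complex z) = z"
  by (simp add: complex_of_quat_def)

lemma H_mu_eq_range: "H_mu = range quat_of_complex"
proof -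
  have "of_real s + unit_mu * of_real t = quat_of_complex (Complex s t)" for s t
    by (simp add: quat_of_complex_def)
  then have "H_mu \<subseteq> range quat_of_complex"
    unfolding H_mu_def by auto
  moreover have "range quat_of_complex \<subseteq> H_mu"
    unfolding H_mu_def quat_of_complex_def by blast
  ultimately show ?thesis ..
qed

lemma quat_of_complex_of_quat: "q \<in> H_mu \<Longrightarrow> quat_of_complex (complex_of_quat q) = q"
  by (auto simp: H_mu_eq_range)

lemma quat_of_complex_mult: "quat_of_complex (z * w) = quat_of_complex z * quat_of_complex w"
  by (simp add: quat_eq_iff)

lemma quat_of_complex_1 [simp]: "quat_of_complex 1 = 1"
  by (simp add: quat_eq_iff)

lemma quat_of_complex_power: "quat_of_complex (z ^ n) = quat_of_complex z ^ n"
  by (induction n) (simp_all add: quat_of_complex_mult)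

lemma quat_of_complex_cnj: "quat_of_complex (cnj z) = qcnj (quat_of_complex z)"
  by (simp add: quat_eq_iff)

lemma norm_quat_of_complex [simp]: "norm (quat_of_complex z) = norm z"
  by (simp add: norm_quat_def cmod_def)

lemma bounded_linear_quat_of_complex: "bounded_linear quat_of_complex"
  by (rule bounded_linear_intro[where K = 1]) (simp_all add: quat_eq_iff)

lemma bounded_linear_complex_of_quat: "bounded_linear complex_of_quat"
proof (rule bounded_linear_intro[where K = 1])
  show "norm (complex_of_quat q) \<le> norm q * 1" for q
    by (simp add: norm_quat_def complex_of_quat_def cmod_def)
qed (simp_all add: complex_of_quat_def complex_eq_iff)

lemma quat_of_complex_inverse: "quat_of_complex (inverse z) = inverse (quat_of_complex z)"
proof (cases "z = 0")
  case False
  then have "quat_of_complex z * quat_of_complex (inverse z) = 1"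
    by (simp flip: quat_of_complex_mult)
  then show ?thesis by (simp add: inverse_unique)
next
  case True
  have "quat_of_complex 0 = 0" by (simp add: quat_eq_iff)
  with True show ?thesis by simp
qed

text \<open>The embedding is multiplicative and bounded linear, so it passes through the exponential
  series term by term.\<close>

lemma quat_of_complex_exp: "quat_of_complex (exp z) = exp (quat_of_complex z)"
  unfolding exp_def
  by (subst bounded_linear.suminf[OF bounded_linear_quat_of_complex summable_exp_generic])
     (simp add: quat_of_complex_power linear_scale[OF bounded_linear.linear[OF bounded_linear_quat_of_complex]])

lemma exp_unit_mu: "exp (unit_mu * of_real t) = quat_of_complex (cis t)"
proof -
  have "unit_mu * of_real t = quat_of_complex (\<i> * of_real t)"
    by (simp add: quat_of_complex_def)
  then show ?thesis
    by (simp add: cis_conv_exp quat_of_complex_exp)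
qed

text \<open>The embedding has a bounded linear left inverse, which carries integrability back; hence
  the identity also holds for non-integrable \<open>f\<close>, where both integrals take the default
  value 0.\<close>

lemma integral_quat_of_complex:
  "(\<integral>x. quat_of_complex (f x) \<partial>M) = quat_of_complex (integral\<^sup>L M f)"
  by (rule integral_bounded_linear'[OF bounded_linear_quat_of_complex bounded_linear_complex_of_quat]) simp

section \<open>The kernel in complex form\<close>

definition lct_const :: "real \<Rightarrow> complex" where
  "lct_const b = inverse (csqrt (Complex 0 (2 * pi * b)))"

text \<open>Only this modulus survives when one transform is multiplied by the conjugate of
  another.\<close>

lemma norm_lct_const: "(norm (lct_const b))\<^sup>2 = 1 / (2 * pi * \<bar>b\<bar>)"
proof -
  have "(norm (lct_const b))\<^sup>2 = inverse ((norm (csqrt (Complex 0 (2 * pi * b))))\<^sup>2)"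
    by (simp only: lct_const_def norm_inverse power_inverse)
  also have "(norm (csqrt (Complex 0 (2 * pi * b))))\<^sup>2 = 2 * pi * \<bar>b\<bar>"
    by (simp add: complex_norm abs_mult)
  finally show ?thesis
    by (simp only: inverse_eq_divide)
qed

lemma lct_kernel_eq:
  fixes A :: "real^2^2"
  defines "a \<equiv> A $ 1 $ 1" and "b \<equiv> A $ 1 $ 2" and "d \<equiv> A $ 2 $ 2"
  shows "lct_kernel A x u =
    quat_of_complex (lct_const b * cis (a / (2 * b) * x\<^sup>2 - 1 / b * x * u + d / (2 * b) * u\<^sup>2))"
proof -
  have *: "Complex (q_re (of_real (2 * pi * b) * unit_mu)) (q_mu (of_real (2 * pi * b) * unit_mu)) =
      Complex 0 (2 * pi * b)"
    by (simp add: of_real_def unit_mu_def)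
  then show ?thesis
    unfolding lct_kernel_def Let_def a_def[symmetric] b_def[symmetric] d_def[symmetric]
      mu_sqrt_def exp_unit_mu quat_of_complex_mult lct_const_def quat_of_complex_inverse *
    by (simp only: divide_inverse mult_1_left)
qed

section \<open>Chirps, Borel versions and the transform as a Fourier transform\<close>

definition chirp :: "real \<Rightarrow> real \<Rightarrow> real \<times> real \<Rightarrow> complex" where
  "chirp s t p = cis (s * (fst p)\<^sup>2 + t * (snd p)\<^sup>2)"

lemma borel_measurable_chirp [measurable]: "chirp s t \<in> borel_measurable borel"
  unfolding chirp_def[abs_def] by (intro borel_measurable_continuous_onI continuous_intros)

lemma norm_chirp [simp]: "norm (chirp s t p) = 1"
  by (simp add: chirp_def)

lemma chirp_mult_cnj: "chirp s t p * cnj (chirp s t p) = 1"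
  by (simp add: chirp_def cis_cnj cis_mult)

text \<open>Links the Lebesgue measurable functions of the statement with the Borel functions of the
  Fourier theory: Borel versions of the real and imaginary parts are chosen separately.\<close>

lemma integrable_lebesgue_ex_lborel:
  fixes f :: "'a::euclidean_space \<Rightarrow> complex"
  assumes f: "integrable lebesgue f"
  obtains g where "integrable lborel g" "AE x in lborel. f x = g x"
proof -
  have "(\<lambda>x. Re (f x)) \<in> borel_measurable lebesgue"
    using borel_measurable_integrable[OF f] by measurable
  from completion_ex_borel_measurable_real[OF this]
  obtain g where [measurable]: "g \<in> borel_measurable lborel" and g: "AE x in lborel. Re (f x) = g x"
    by (rule bexE)
  have "(\<lambda>x. Im (f x)) \<in> borel_measurable lebesgue"
    using borel_measurable_integrable[OF f] by measurable
  from completion_ex_borel_measurable_real[OF this]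
  obtain h where [measurable]: "h \<in> borel_measurable lborel" and h: "AE x in lborel. Im (f x) = h x"
    by (rule bexE)
  let ?k = "\<lambda>x. Complex (g x) (h x)"
  have m: "?k \<in> borel_measurable lborel"
    unfolding borel_measurable_complex_iff by simp
  have AE: "AE x in lborel. f x = ?k x"
    using g h by eventually_elim (simp add: complex_eq_iff)
  then have "AE x in lebesgue. f x = ?k x"
    by (rule AE_completion)
  then have "integrable lebesgue ?k"
    using integrable_cong_AE_imp[OF f measurable_completion[OF m]] by (simp add: eq_commute)
  then have "integrable lborel ?k"
    using integrable_completion[OF m] by simp
  then show ?thesis
    using AE by (rule that)
qed

text \<open>Reflection is the diagonal affine map with all coefficients -1, so its Jacobian is 1 and
  it preserves Lebesgue measure. This handles the reflected \<open>g\<close> in the definition of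
  \<open>r\<close>.\<close>

lemma integrable_lebesgue_uminus:
  fixes f :: "'a::euclidean_space \<Rightarrow> 'b::{banach, second_countable_topology}"
  assumes "integrable lebesgue f"
  shows "integrable lebesgue (\<lambda>x. f (- x))"
proof -
  have T: "(\<lambda>x::'a. 0 + (\<Sum>j\<in>Basis. ((- 1) * (x \<bullet> j)) *\<^sub>R j)) = uminus"
    by (simp add: fun_eq_iff sum_negf euclidean_representation)
  have "lebesgue = density (distr lebesgue lebesgue (uminus :: 'a \<Rightarrow> 'a)) (\<lambda>_. ennreal (\<Prod>j\<in>(Basis :: 'a set). \<bar>- 1\<bar>))"
    by (rule lebesgue_affine_euclidean[of "\<lambda>_. - 1" "0 :: 'a", unfolded T]) simp
  also have "\<dots> = distr lebesgue lebesgue uminus"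
    by (simp add: density_1)
  finally have eq: "distr lebesgue lebesgue (uminus :: 'a \<Rightarrow> 'a) = lebesgue" ..
  have "(uminus :: 'a \<Rightarrow> 'a) \<in> lebesgue \<rightarrow>\<^sub>M lebesgue"
    using lebesgue_affine_measurable[of "\<lambda>_. - 1" "0 :: 'a"] unfolding T by simp
  moreover have "integrable (distr lebesgue lebesgue uminus) f"
    using assms by (simp add: eq)
  ultimately show ?thesis
    by (intro integrable_distr[of uminus lebesgue lebesgue f])
qed

lemma Lp_mu_1_iff: "f \<in> Lp_mu 1 \<longleftrightarrow> range f \<subseteq> H_mu \<and> integrable lebesgue f"
  by (auto simp: Lp_mu_def integrable_iff_bounded)

text \<open>The phase of the two kernels splits into three: the terms in \<open>a\<^sub>1\<close>,
  \<open>a\<^sub>2\<close> form the chirp absorbed into \<open>\<Phi>\<close>, the mixed terms form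
  the Fourier phase at \<open>(u / b\<^sub>1, v / b\<^sub>2)\<close>, and the terms in
  \<open>d\<^sub>1\<close>, \<open>d\<^sub>2\<close> leave the integral. \<open>\<Phi>\<close> is a
  Borel version, so that \<open>ft\<close> applies.\<close>

lemma qlct_eq_ft:
  fixes A\<^sub>1 A\<^sub>2 :: "real^2^2" and \<phi> \<Phi> :: "real \<times> real \<Rightarrow> complex"
  defines "a\<^sub>1 \<equiv> A\<^sub>1 $ 1 $ 1" and "b\<^sub>1 \<equiv> A\<^sub>1 $ 1 $ 2" and "d\<^sub>1 \<equiv> A\<^sub>1 $ 2 $ 2"
    and "a\<^sub>2 \<equiv> A\<^sub>2 $ 1 $ 1" and "b\<^sub>2 \<equiv> A\<^sub>2 $ 1 $ 2" and "d\<^sub>2 \<equiv> A\<^sub>2 $ 2 $ 2"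
  assumes \<phi>: "\<phi> \<in> borel_measurable lebesgue" and \<Phi>: "integrable lborel \<Phi>"
    and AE: "AE p in lborel. chirp (a\<^sub>1 / (2 * b\<^sub>1)) (a\<^sub>2 / (2 * b\<^sub>2)) p * \<phi> p = \<Phi> p"
  shows "qlct A\<^sub>1 A\<^sub>2 (\<lambda>p. quat_of_complex (\<phi> p)) w = quat_of_complex
    (lct_const b\<^sub>1 * lct_const b\<^sub>2 * chirp (d\<^sub>1 / (2 * b\<^sub>1)) (d\<^sub>2 / (2 * b\<^sub>2)) w *
      ft \<Phi> (fst w / b\<^sub>1, snd w / b\<^sub>2))"
proof -
  obtain u v where w: "w = (u, v)" by force
  have [measurable]: "\<Phi> \<in> borel_measurable borel"
    using \<Phi> by (auto dest: borel_measurable_integrable)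
  let ?c = "lct_const b\<^sub>1 * lct_const b\<^sub>2 * chirp (d\<^sub>1 / (2 * b\<^sub>1)) (d\<^sub>2 / (2 * b\<^sub>2)) w"
  let ?ch = "chirp (a\<^sub>1 / (2 * b\<^sub>1)) (a\<^sub>2 / (2 * b\<^sub>2))"
  let ?\<xi> = "(u / b\<^sub>1, v / b\<^sub>2)"
  define E where "E p = cis (- (p \<bullet> ?\<xi>))" for p
  have E [measurable]: "E \<in> borel_measurable borel"
    unfolding E_def[abs_def] by measurable
  \<comment> \<open>All three factors lie in the image of the commutative field of complex numbers,
    so the kernels on both sides of \<open>\<phi>\<close> can be merged.\<close>
  have kernel: "lct_kernel A\<^sub>1 (fst p) u * quat_of_complex (\<phi> p) * lct_kernel A\<^sub>2 (snd p) v =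
      quat_of_complex (?c * (E p * (?ch p * \<phi> p)))" for p
  proof -
    have "cis (a\<^sub>1 / (2 * b\<^sub>1) * (fst p)\<^sup>2 - 1 / b\<^sub>1 * fst p * u + d\<^sub>1 / (2 * b\<^sub>1) * u\<^sup>2) *
        cis (a\<^sub>2 / (2 * b\<^sub>2) * (snd p)\<^sup>2 - 1 / b\<^sub>2 * snd p * v + d\<^sub>2 / (2 * b\<^sub>2) * v\<^sup>2) =
        chirp (d\<^sub>1 / (2 * b\<^sub>1)) (d\<^sub>2 / (2 * b\<^sub>2)) w * (E p * ?ch p)"
      by (cases p) (simp add: E_def chirp_def w cis_mult algebra_simps)
    then show ?thesis
      unfolding lct_kernel_eq a\<^sub>1_def[symmetric] b\<^sub>1_def[symmetric] d\<^sub>1_def[symmetric]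
        a\<^sub>2_def[symmetric] b\<^sub>2_def[symmetric] d\<^sub>2_def[symmetric] quat_of_complex_mult[symmetric]
      by (intro arg_cong[where f = quat_of_complex]) (simp add: algebra_simps)
  qed
  have m: "E \<in> borel_measurable lebesgue" "?ch \<in> borel_measurable lebesgue"
    "\<Phi> \<in> borel_measurable lebesgue"
    by (auto intro!: measurable_completion)
  have "qlct A\<^sub>1 A\<^sub>2 (\<lambda>p. quat_of_complex (\<phi> p)) w =
      (\<integral>p. quat_of_complex (?c * (E p * (?ch p * \<phi> p))) \<partial>lebesgue)"
    unfolding qlct_def w split kernel[unfolded w, symmetric] by (simp add: case_prod_unfold)
  also have "\<dots> = quat_of_complex (?c * (\<integral>p. E p * (?ch p * \<phi> p) \<partial>lebesgue))"
    by (simp only: integral_quat_of_complex integral_mult_right_zero)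
  also have "(\<integral>p. E p * (?ch p * \<phi> p) \<partial>lebesgue) = (\<integral>p. E p * \<Phi> p \<partial>lebesgue)"
  proof (rule integral_cong_AE)
    show "AE p in lebesgue. E p * (?ch p * \<phi> p) = E p * \<Phi> p"
      using AE_completion[OF AE] by eventually_elim simp
  qed (intro borel_measurable_times m \<phi>)+
  also have "\<dots> = ft \<Phi> ?\<xi>"
    unfolding ft_def E_def[symmetric] by (rule integral_completion) measurable
  finally show ?thesis
    by (simp add: w)
qed

section \<open>Reduction of the quaternion identity to Parseval's identity\<close>

theorem theorem4:
  fixes A\<^sub>1 A\<^sub>2 :: "real^2^2"
    and f g r :: "real \<times> real \<Rightarrow> quat"
  assumes "det A\<^sub>1 = 1" and "A\<^sub>1 $ 1 $ 2 \<noteq> 0"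
    and "det A\<^sub>2 = 1" and "A\<^sub>2 $ 1 $ 2 \<noteq> 0"
    and "f \<in> Lp_mu 1 \<inter> Lp_mu 2"
    and "g \<in> Lp_mu 1 \<inter> Lp_mu 2"
    and "qlct A\<^sub>1 A\<^sub>2 f \<in> Lp_mu 1 \<inter> Lp_mu 2"
    and "qlct A\<^sub>1 A\<^sub>2 g \<in> Lp_mu 1 \<inter> Lp_mu 2"
    and "\<And>\<tau>\<^sub>1 \<tau>\<^sub>2. qcnj (r (\<tau>\<^sub>1, \<tau>\<^sub>2)) =
           exp (unit_mu * of_real (\<tau>\<^sub>1\<^sup>2 * (A\<^sub>1 $ 1 $ 1 / A\<^sub>1 $ 1 $ 2))) * g (- \<tau>\<^sub>1, - \<tau>\<^sub>2) *
           exp (unit_mu * of_real (\<tau>\<^sub>2\<^sup>2 * (A\<^sub>2 $ 1 $ 1 / A\<^sub>2 $ 1 $ 2)))"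
  shows "(\<integral>\<tau>. f \<tau> * qcnj (r \<tau>) \<partial>lebesgue) =
         (\<integral>w. qlct A\<^sub>1 A\<^sub>2 f w * qcnj (qlct A\<^sub>1 A\<^sub>2 r w) \<partial>lebesgue)"
proof -
  define a\<^sub>1 b\<^sub>1 d\<^sub>1 where "a\<^sub>1 = A\<^sub>1 $ 1 $ 1" and "b\<^sub>1 = A\<^sub>1 $ 1 $ 2" and "d\<^sub>1 = A\<^sub>1 $ 2 $ 2"
  define a\<^sub>2 b\<^sub>2 d\<^sub>2 where "a\<^sub>2 = A\<^sub>2 $ 1 $ 1" and "b\<^sub>2 = A\<^sub>2 $ 1 $ 2" and "d\<^sub>2 = A\<^sub>2 $ 2 $ 2"
  have b: "b\<^sub>1 \<noteq> 0" "b\<^sub>2 \<noteq> 0"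
    using assms(2,4) by (simp_all add: b\<^sub>1_def b\<^sub>2_def)
  define \<phi> where "\<phi> p = complex_of_quat (f p)" for p
  define \<gamma> where "\<gamma> p = complex_of_quat (g p)" for p
  \<comment> \<open>The defining relation gives the conjugate of \<open>r\<close>; conjugating once
    more yields this complex form of \<open>r\<close>.\<close>
  define \<rho> where "\<rho> p = cnj (chirp (a\<^sub>1 / b\<^sub>1) (a\<^sub>2 / b\<^sub>2) p * \<gamma> (- p))" for p
  have f: "f = (\<lambda>p. quat_of_complex (\<phi> p))" and g: "g = (\<lambda>p. quat_of_complex (\<gamma> p))"
    using assms(5,6) by (simp_all add: \<phi>_def \<gamma>_def Lp_mu_1_iff quat_of_complex_of_quat range_subsetD)
  have r: "r = (\<lambda>p. quat_of_complex (\<rho> p))"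
  proof
    fix p :: "real \<times> real"
    have "qcnj (r p) = quat_of_complex (chirp (a\<^sub>1 / b\<^sub>1) (a\<^sub>2 / b\<^sub>2) p * \<gamma> (- p))"
      using assms(9)[of "fst p" "snd p"]
      unfolding a\<^sub>1_def[symmetric] b\<^sub>1_def[symmetric] a\<^sub>2_def[symmetric] b\<^sub>2_def[symmetric] g exp_unit_mu
        quat_of_complex_mult[symmetric]
      by (cases p) (simp add: chirp_def cis_mult[symmetric] mult_ac)
    then have "qcnj (qcnj (r p)) = quat_of_complex (\<rho> p)"
      by (simp only: \<rho>_def quat_of_complex_cnj)
    then show "r p = quat_of_complex (\<rho> p)"
      by (simp add: quat_eq_iff)
  qed
  have i\<phi>: "integrable lebesgue \<phi>" and i\<gamma>: "integrable lebesgue \<gamma>"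
    using assms(5,6) unfolding \<phi>_def[abs_def] \<gamma>_def[abs_def]
    by (auto simp: Lp_mu_1_iff intro: integrable_bounded_linear[OF bounded_linear_complex_of_quat])
  have chirp_int: "integrable lebesgue (\<lambda>p. chirp s t p * h p)" if "integrable lebesgue h" for s t h
    unfolding chirp_def by (rule integrable_cis_mult[OF that])
      (intro measurable_completion, simp, intro borel_measurable_continuous_onI continuous_intros)
  have i\<rho>: "integrable lebesgue \<rho>"
    unfolding \<rho>_def[abs_def] by (intro integrable_cnj chirp_int integrable_lebesgue_uminus i\<gamma>)
  \<comment> \<open>The chirp that the kernels attach to every input; the same one multiplies
    \<open>\<phi>\<close> and \<open>\<rho>\<close>.\<close>
  let ?ch = "chirp (a\<^sub>1 / (2 * b\<^sub>1)) (a\<^sub>2 / (2 * b\<^sub>2))"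
  obtain F where F: "integrable lborel F" "AE p in lborel. ?ch p * \<phi> p = F p"
    using integrable_lebesgue_ex_lborel[OF chirp_int[OF i\<phi>]] by blast
  obtain R where R: "integrable lborel R" "AE p in lborel. ?ch p * \<rho> p = R p"
    using integrable_lebesgue_ex_lborel[OF chirp_int[OF i\<rho>]] by blast
  have [measurable]: "F \<in> borel_measurable borel" "R \<in> borel_measurable borel"
    using F R by (auto dest: borel_measurable_integrable)
  have m: "\<phi> \<in> borel_measurable lebesgue" "\<rho> \<in> borel_measurable lebesgue"
    using i\<phi> i\<rho> by (auto dest: borel_measurable_integrable)
  define S where "S w = (fst w / b\<^sub>1, snd w / b\<^sub>2)" for w :: "real \<times> real"
  have S: "S w = 0 + (inverse b\<^sub>1 * fst w, inverse b\<^sub>2 * snd w)" for w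
    by (simp add: S_def divide_inverse mult.commute)
  have [measurable]: "S \<in> borel_measurable borel"
    unfolding S_def[abs_def] divide_inverse by (intro borel_measurable_continuous_onI continuous_intros)
  define c where "c w = lct_const b\<^sub>1 * lct_const b\<^sub>2 * chirp (d\<^sub>1 / (2 * b\<^sub>1)) (d\<^sub>2 / (2 * b\<^sub>2)) w" for w
  have [measurable]: "c \<in> borel_measurable borel"
    unfolding c_def[abs_def] by measurable
  \<comment> \<open>The prefactor \<open>c\<close> has constant modulus, so its phase disappears
    from the product of the transforms.\<close>
  have norm_c: "(norm (c w))\<^sup>2 = 1 / ((2 * pi)\<^sup>2 * \<bar>b\<^sub>1 * b\<^sub>2\<bar>)" for w
    by (simp add: c_def norm_mult power_mult_distrib norm_lct_const abs_mult) (simp add: power2_eq_square)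
  have Lf: "qlct A\<^sub>1 A\<^sub>2 f w = quat_of_complex (c w * ft F (S w))" for w
    unfolding f c_def S_def b\<^sub>1_def b\<^sub>2_def d\<^sub>1_def d\<^sub>2_def
    by (rule qlct_eq_ft[OF m(1) F[unfolded a\<^sub>1_def a\<^sub>2_def b\<^sub>1_def b\<^sub>2_def]])
  have Lr: "qlct A\<^sub>1 A\<^sub>2 r w = quat_of_complex (c w * ft R (S w))" for w
    unfolding r c_def S_def b\<^sub>1_def b\<^sub>2_def d\<^sub>1_def d\<^sub>2_def
    by (rule qlct_eq_ft[OF m(2) R[unfolded a\<^sub>1_def a\<^sub>2_def b\<^sub>1_def b\<^sub>2_def]])
  have iF: "integrable lborel (ft F)"
  proof -
    have "integrable lebesgue (\<lambda>w. complex_of_quat (qlct A\<^sub>1 A\<^sub>2 f w))"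
      using assms(7) by (auto simp: Lp_mu_1_iff intro: integrable_bounded_linear[OF bounded_linear_complex_of_quat])
    then have "integrable lebesgue (\<lambda>w. c w * ft F (S w))"
      by (simp add: Lf)
    then have 1: "integrable lborel (\<lambda>w. c w * ft F (S w))"
      by (subst (asm) integrable_completion) simp_all
    have "integrable lborel (\<lambda>w. ft F (S w))"
    proof (rule Bochner_Integration.integrable_bound)
      \<comment> \<open>The real factor is the reciprocal of the constant modulus of
        \<open>c w\<close>; integrability of the transform of \<open>f\<close> thus passes to
        \<open>ft F\<close>.\<close>
      show "integrable lborel (\<lambda>w. complex_of_real (2 * pi * sqrt \<bar>b\<^sub>1 * b\<^sub>2\<bar>) * (c w * ft F (S w)))"
        using 1 by (rule integrable_mult_right)
      have "norm (c w) = 1 / (2 * pi * sqrt \<bar>b\<^sub>1 * b\<^sub>2\<bar>)" for w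
        by (rule power2_eq_imp_eq) (simp_all add: norm_c power_divide power_mult_distrib)
      then show "AE w in lborel. norm (ft F (S w)) \<le>
          norm (complex_of_real (2 * pi * sqrt \<bar>b\<^sub>1 * b\<^sub>2\<bar>) * (c w * ft F (S w)))"
        using b by (simp add: norm_mult)
    qed measurable
    then show ?thesis
      using b by (subst (asm) S, subst (asm) integrable_affine_prod_iff) simp_all
  qed
  let ?h = "\<lambda>\<xi>. ft F \<xi> * cnj (ft R \<xi>)"
  have "(\<integral>w. qlct A\<^sub>1 A\<^sub>2 f w * qcnj (qlct A\<^sub>1 A\<^sub>2 r w) \<partial>lebesgue) =
      quat_of_complex (\<integral>w. (c w * ft F (S w)) * cnj (c w * ft R (S w)) \<partial>lebesgue)"
    unfolding Lf Lr quat_of_complex_cnj[symmetric] quat_of_complex_mult[symmetric]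
    by (rule integral_quat_of_complex)
  also have "(\<integral>w. (c w * ft F (S w)) * cnj (c w * ft R (S w)) \<partial>lebesgue) =
      (\<integral>w. 1 / ((2 * pi)\<^sup>2 * \<bar>b\<^sub>1 * b\<^sub>2\<bar>) * ?h (S w) \<partial>lebesgue)"
  proof (rule Bochner_Integration.integral_cong[OF refl])
    fix w
    have "(c w * ft F (S w)) * cnj (c w * ft R (S w)) = (c w * cnj (c w)) * ?h (S w)"
      by (simp only: complex_cnj_mult mult_ac)
    also have "c w * cnj (c w) = of_real (1 / ((2 * pi)\<^sup>2 * \<bar>b\<^sub>1 * b\<^sub>2\<bar>))"
      unfolding norm_c[of w, symmetric] by (simp only: complex_norm_square)
    finally show "(c w * ft F (S w)) * cnj (c w * ft R (S w)) = 1 / ((2 * pi)\<^sup>2 * \<bar>b\<^sub>1 * b\<^sub>2\<bar>) * ?h (S w)"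
      by simp
  qed
  also have "\<dots> = 1 / ((2 * pi)\<^sup>2 * \<bar>b\<^sub>1 * b\<^sub>2\<bar>) * (\<integral>w. ?h (S w) \<partial>lborel)"
    unfolding integral_mult_right_zero by (subst integral_completion) simp_all
  \<comment> \<open>Undoing the frequency scaling gives a Jacobian that cancels
    \<open>\<bar>b\<^sub>1 * b\<^sub>2\<bar>\<close> in the modulus of \<open>c\<close>; the
    remaining \<open>(2 * pi)\<^sup>2\<close> cancels against Parseval's identity.\<close>
  also have "(\<integral>w. ?h (S w) \<partial>lborel) = \<bar>b\<^sub>1 * b\<^sub>2\<bar> * integral\<^sup>L lborel ?h"
  proof -
    have "integral\<^sup>L lborel ?h = \<bar>inverse b\<^sub>1 * inverse b\<^sub>2\<bar> *\<^sub>R (\<integral>w. ?h (S w) \<partial>lborel)"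
      unfolding S using b by (intro integral_affine_prod) simp_all
    moreover have "\<bar>b\<^sub>1 * b\<^sub>2\<bar> * \<bar>inverse b\<^sub>1 * inverse b\<^sub>2\<bar> = 1"
      using b by (simp add: abs_mult divide_simps)
    ultimately show ?thesis
      by (simp only: scaleR_conv_of_real mult.assoc[symmetric] of_real_mult[symmetric]) simp
  qed
  also have "integral\<^sup>L lborel ?h = (2 * pi)\<^sup>2 * (\<integral>p. F p * cnj (R p) \<partial>lborel)"
    by (rule ft_parseval[OF F(1) iF R(1)])
  also have "1 / ((2 * pi)\<^sup>2 * \<bar>b\<^sub>1 * b\<^sub>2\<bar>) * (\<bar>b\<^sub>1 * b\<^sub>2\<bar> * ((2 * pi)\<^sup>2 * (\<integral>p. F p * cnj (R p) \<partial>lborel))) =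
      (\<integral>p. F p * cnj (R p) \<partial>lborel)"
    using b by simp
  also have "\<dots> = (\<integral>p. F p * cnj (R p) \<partial>lebesgue)"
    by (rule integral_completion[symmetric]) measurable
  also have "\<dots> = (\<integral>p. \<phi> p * cnj (\<rho> p) \<partial>lebesgue)"
  proof (rule integral_cong_AE)
    show "(\<lambda>p. F p * cnj (R p)) \<in> borel_measurable lebesgue"
      by (rule measurable_completion) measurable
    show "(\<lambda>p. \<phi> p * cnj (\<rho> p)) \<in> borel_measurable lebesgue"
      using m by measurable
    have "AE p in lborel. F p * cnj (R p) = \<phi> p * cnj (\<rho> p)"
      using F(2) R(2)
    proof eventually_elim
      case (elim p)
      \<comment> \<open>The common chirp meets its own conjugate, and the product is 1.\<close>
      have "F p * cnj (R p) = (?ch p * cnj (?ch p)) * (\<phi> p * cnj (\<rho> p))"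
        unfolding elim[symmetric] by (simp only: complex_cnj_mult mult_ac)
      then show ?case by (simp add: chirp_mult_cnj)
    qed
    then show "AE p in lebesgue. F p * cnj (R p) = \<phi> p * cnj (\<rho> p)"
      by (rule AE_completion)
  qed
  also have "quat_of_complex \<dots> = (\<integral>\<tau>. f \<tau> * qcnj (r \<tau>) \<partial>lebesgue)"
    unfolding f r quat_of_complex_cnj[symmetric] quat_of_complex_mult[symmetric]
    by (rule integral_quat_of_complex[symmetric])
  finally show ?thesis ..
qed

end
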